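(* Let $\beta \in (0,1)$ be fixed, set $\varepsilon_n = n^{-\beta}$, and let $(\sigma_n)$ be a sequence of positive numbers. Consider, as $n \to \infty$, the problem of testing, based on $X_1,\dots,X_n$, the null hypothesis $\mathcal{H}_0$ that $X_1,\dots,X_n$ are iid $\mathcal{N}(0,1)$ versus the alternative $\mathcal{H}_1$ that $X_1,\dots,X_n$ are iid from the mixture $(1-\varepsilon_n)\,\mathcal{N}(0,1) + \varepsilon_n\,\mathcal{N}(0,\sigma_n^2)$. (i) If $\sigma_n = n^{-\gamma}$ with $\gamma > 0$ fixed, then the extremes test is asymptotically powerful when $\gamma > \beta$, and asymptotically powerless when $\gamma < \beta$. (ii) If instead $\sigma_n = \sigma > 0$ is fixed, then the extremes test is asymptotically powerful when $\sigma > 1/\sqrt{1-\beta}$, and asymptotically powerless when $\sigma < 1/\sqrt{1-\beta}$.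
   Context: $\mathcal{N}(0,s^2)$ denotes the centered Gaussian distribution on $\mathbb{R}$ with variance $s^2$. The asymptotic regime is $n \to \infty$, and only $n$ large enough that $\varepsilon_n < 1/2$ is considered. The extremes test combines, using Bonferroni's method, the test that rejects for small values of $\min_i |X_i|$ and the test that rejects for large values of $\max_i |X_i|$. That is, at level $\alpha \in (0,1)$ its rejection region is $\{\min_i |X_i| \le c_n\} \cup \{\max_i |X_i| \ge d_n\}$, where $c_n$ and $d_n$ are defined by $[2(1-\Phi(c_n))]^n = 1 - \alpha/2$ and $[2\Phi(d_n) - 1]^n = 1-\alpha/2$, with $\Phi$ the standard normal distribution function (so each of the two tests has level $\alpha/2$ under $\mathcal{H}_0$). The risk of a test is the sum of its probabilities of Type I error (rejecting under $\mathcal{H}_0$) and Type II error (not rejecting under $\mathcal{H}_1$). A sequence of tests is asymptotically powerless if the limit inferior of its risk as $n\to\infty$ is at least $1$, and asymptotically powerful if its risk tends to $0$. The extremes test is said to be asymptotically powerful if this holds for some choice of levels $\alpha = \alpha_n \in (0,1)$, and asymptotically powerless if this holds for every choice of levels $\alpha = \alpha_n\in(0,1)$. *)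

theory Defs
  imports "HOL-Probability.Probability"
begin

text \<open>Centered Gaussian law on the reals; the parameter is the standard deviation \<open>s\<close>
  (meaningful for \<open>s > 0\<close>), so the variance is \<open>s\<^sup>2\<close>.\<close>

definition centered_normal :: "real \<Rightarrow> real measure" where
  "centered_normal s = density lborel (\<lambda>x. ennreal (normal_density 0 s x))"

definition normal_mixture :: "real \<Rightarrow> real \<Rightarrow> real measure" where
  "normal_mixture \<epsilon> s =
     density lborel (\<lambda>x. ennreal ((1 - \<epsilon>) * normal_density 0 1 x + \<epsilon> * normal_density 0 s x))"

text \<open>The density above is that of the convex combination of the two laws:\<close>

lemma emeasure_normal_mixture:
  assumes "0 \<le> \<epsilon>" "\<epsilon> \<le> 1" "A \<in> sets borel"
  shows "emeasure (normal_mixture \<epsilon> s) A =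
    ennreal (1 - \<epsilon>) * emeasure (centered_normal 1) A + ennreal \<epsilon> * emeasure (centered_normal s) A"
proof -
  have eq: "ennreal ((1 - \<epsilon>) * normal_density 0 1 x + \<epsilon> * normal_density 0 s x) * indicator A x =
      ennreal (1 - \<epsilon>) * (ennreal (normal_density 0 1 x) * indicator A x) +
      ennreal \<epsilon> * (ennreal (normal_density 0 s x) * indicator A x)" for x
    using assms(1,2)
    by (simp add: ennreal_plus ennreal_mult normal_density_nonneg distrib_right mult.assoc)
  show ?thesis
    unfolding normal_mixture_def centered_normal_def using assms(3)
    by (simp add: emeasure_density eq nn_integral_add nn_integral_cmult)
qed

text \<open>Joint law of an iid sample \<open>X\<^sub>1, \<dots>, X\<^sub>n\<close> with common law \<open>P\<close>.\<close>

definition iid_sample :: "nat \<Rightarrow> real measure \<Rightarrow> (nat \<Rightarrow> real) measure" where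
  "iid_sample n P = (\<Pi>\<^sub>M i\<in>{1..n}. P)"

definition H0 :: "nat \<Rightarrow> (nat \<Rightarrow> real) measure" where
  "H0 n = iid_sample n (centered_normal 1)"

definition H1 :: "real \<Rightarrow> real \<Rightarrow> nat \<Rightarrow> (nat \<Rightarrow> real) measure" where
  "H1 \<epsilon> s n = iid_sample n (normal_mixture \<epsilon> s)"

abbreviation std_normal_cdf :: "real \<Rightarrow> real" ("\<Phi>") where
  "\<Phi> \<equiv> cdf std_normal_distribution"

definition min_threshold :: "nat \<Rightarrow> real \<Rightarrow> real" where
  "min_threshold n \<alpha> = (THE c. (2 * (1 - \<Phi> c)) ^ n = 1 - \<alpha> / 2)"

text \<open>The constraint \<open>0 \<le> d\<close> is needed for uniqueness: for even \<open>n\<close> the equation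
  also has a negative solution.\<close>

definition max_threshold :: "nat \<Rightarrow> real \<Rightarrow> real" where
  "max_threshold n \<alpha> = (THE d. 0 \<le> d \<and> (2 * \<Phi> d - 1) ^ n = 1 - \<alpha> / 2)"

text \<open>Tests are represented by their rejection regions, as sets of samples indexed by \<open>{1..n}\<close>.\<close>

definition extremes_test :: "nat \<Rightarrow> real \<Rightarrow> (nat \<Rightarrow> real) set" where
  "extremes_test n \<alpha> = {x \<in> {1..n} \<rightarrow>\<^sub>E UNIV.
     Min ((\<lambda>i. \<bar>x i\<bar>) ` {1..n}) \<le> min_threshold n \<alpha> \<or>
     Max ((\<lambda>i. \<bar>x i\<bar>) ` {1..n}) \<ge> max_threshold n \<alpha>}"

definition risk :: "'a measure \<Rightarrow> 'a measure \<Rightarrow> 'a set \<Rightarrow> real" where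
  "risk P0 P1 R = measure P0 R + measure P1 (space P1 - R)"

definition asymptotically_powerful ::
    "(nat \<Rightarrow> 'a measure) \<Rightarrow> (nat \<Rightarrow> 'a measure) \<Rightarrow> (nat \<Rightarrow> 'a set) \<Rightarrow> bool" where
  "asymptotically_powerful P0 P1 R \<longleftrightarrow> (\<lambda>n. risk (P0 n) (P1 n) (R n)) \<longlonglongrightarrow> 0"

definition asymptotically_powerless ::
    "(nat \<Rightarrow> 'a measure) \<Rightarrow> (nat \<Rightarrow> 'a measure) \<Rightarrow> (nat \<Rightarrow> 'a set) \<Rightarrow> bool" where
  "asymptotically_powerless P0 P1 R \<longleftrightarrow> liminf (\<lambda>n. ereal (risk (P0 n) (P1 n) (R n))) \<ge> 1"

definition extremes_test_powerful :: "(nat \<Rightarrow> real) \<Rightarrow> (nat \<Rightarrow> real) \<Rightarrow> bool" where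
  "extremes_test_powerful \<epsilon> \<sigma> \<longleftrightarrow>
     (\<exists>\<alpha>. (\<forall>n. 0 < \<alpha> n \<and> \<alpha> n < 1) \<and>
        asymptotically_powerful H0 (\<lambda>n. H1 (\<epsilon> n) (\<sigma> n) n) (\<lambda>n. extremes_test n (\<alpha> n)))"

definition extremes_test_powerless :: "(nat \<Rightarrow> real) \<Rightarrow> (nat \<Rightarrow> real) \<Rightarrow> bool" where
  "extremes_test_powerless \<epsilon> \<sigma> \<longleftrightarrow>
     (\<forall>\<alpha>. (\<forall>n. 0 < \<alpha> n \<and> \<alpha> n < 1) \<longrightarrow>
        asymptotically_powerless H0 (\<lambda>n. H1 (\<epsilon> n) (\<sigma> n) n) (\<lambda>n. extremes_test n (\<alpha> n)))"

end

theory Submission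
  imports Defs "HOL-Real_Asymp.Real_Asymp"
begin

text \<open>Write \<open>T x\<close> for the probability that a standard normal variable exceeds \<open>x\<close> in absolute
  value. With \<open>(1 - \<delta>)\<^sup>n = 1 - \<alpha> / 2\<close> the two thresholds satisfy \<open>T c = 1 - \<delta>\<close> and \<open>T d = \<delta>\<close>, and
  \<open>n * \<delta>\<close> lies between \<open>\<alpha> / 2\<close> and \<open>\<alpha>\<close>. The test accepts iff all \<open>\<bar>X\<^sub>i\<bar>\<close> lie strictly between \<open>c\<close> and
  \<open>d\<close>, so by independence both error probabilities are governed by \<open>n\<close>-th powers of one-sample
  probabilities (lemma \<open>risk_extremes_test\<close>).

  A non-null effect, that is a draw from the law of standard deviation \<open>s\<close>, has absolute value
  outside \<open>(c, d)\<close> with probability \<open>extreme_mass\<close> \<open>= (1 - T (c / s)) + T (d / s)\<close>, so the sample contains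
  \<open>n * \<epsilon> * extreme_mass\<close> extreme effects on average. This one number decides everything
  (lemma \<open>risk_bounds\<close>): the risk is at least one minus it, since a difference of \<open>n\<close>-th powers of
  numbers in \<open>[0, 1]\<close> is at most \<open>n\<close> times their difference; and the risk is at most \<open>2 * \<alpha>\<close> plus
  the exponential of minus it. It remains to estimate it to polynomial order in \<open>n\<close>.

  Near the origin, \<open>1 - T x\<close> is of order \<open>min x 1\<close>. Hence \<open>c\<close> is of order \<open>\<delta>\<close>, and shrinking the
  standard deviation to \<open>s\<close> multiplies the central mass by \<open>1 / s\<close>, up to saturation. With
  \<open>s = n powr - \<gamma>\<close> the expected number of extreme effects at the center is then of order
  \<open>n * \<delta> * n powr (\<gamma> - \<beta>)\<close>, capped by the expected number \<open>n powr (1 - \<beta>)\<close> of all effects.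

  In the tail, \<open>T x\<close> is \<open>exp (- x\<^sup>2 / 2)\<close> up to subexponential factors. Hence \<open>T (d / s)\<close> is
  \<open>T d = \<delta>\<close> to the power \<open>1 / s\<^sup>2\<close>, up to an arbitrarily small loss in the exponent
  (lemma \<open>two_sided_tail_power_compare\<close>). For fixed \<open>s\<close> the center contributes at most
  about \<open>n powr - \<beta>\<close> extreme effects, so a growing number can come from the tail alone. There the
  number is about \<open>n powr (1 - \<beta> - 1 / s\<^sup>2)\<close> when \<open>\<delta>\<close> is close to \<open>1 / n\<close>, and
  the sign of this exponent changes at \<open>s = 1 / sqrt (1 - \<beta>)\<close>.

  A powerful choice of levels is a power of \<open>n\<close> with a negative exponent close to \<open>0\<close>: the level
  must tend to \<open>0\<close>, but so slowly that the exponents above stay positive. For powerlessness the bounds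
  hold uniformly in the level, because \<open>n * \<delta>\<close> never exceeds \<open>1\<close>.\<close>

section \<open>Two-sided tails of centered Gaussian laws\<close>

interpretation std_normal: real_distribution std_normal_distribution
  by (rule real_dist_normal_dist)

text \<open>The mass of an interval is its length times a value between the extremes of the density
  there. Strict monotonicity and all lower bounds on increments of \<open>\<Phi>\<close> below rest on this.\<close>

lemma std_normal_cdf_increment_bounds:
  assumes "a \<le> b" "0 \<le> L" "0 \<le> U"
    and "\<And>x. a < x \<Longrightarrow> x \<le> b \<Longrightarrow> L \<le> std_normal_density x"
    and "\<And>x. a < x \<Longrightarrow> x \<le> b \<Longrightarrow> std_normal_density x \<le> U"
  shows "L * (b - a) \<le> \<Phi> b - \<Phi> a" and "\<Phi> b - \<Phi> a \<le> U * (b - a)"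
proof -
  let ?I = "\<integral>\<^sup>+x. ennreal (std_normal_density x) * indicator {a<..b} x \<partial>lborel"
  have inc: "ennreal (\<Phi> b - \<Phi> a) = ?I"
  proof (cases "a = b")
    case False
    then have "\<Phi> b - \<Phi> a = measure std_normal_distribution {a<..b}"
      using std_normal.cdf_diff_eq[of a b] assms(1) by simp
    then show ?thesis
      by (simp add: std_normal.emeasure_eq_measure[symmetric] emeasure_density)
  qed (use assms in simp)
  have const: "(\<integral>\<^sup>+x. ennreal c * indicator {a<..b} x \<partial>lborel) = ennreal (c * (b - a))" if "0 \<le> c" for c
    using that assms(1) by (simp add: nn_integral_cmult_indicator ennreal_mult)
  have mono: "\<Phi> a \<le> \<Phi> b"
    using assms(1) by (rule std_normal.cdf_nondecreasing)
  have "ennreal (L * (b - a)) \<le> ?I"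
    unfolding const[OF assms(2), symmetric]
    by (intro nn_integral_mono) (auto simp: assms ennreal_leI split: split_indicator)
  then show "L * (b - a) \<le> \<Phi> b - \<Phi> a"
    unfolding inc[symmetric] using mono by (simp add: ennreal_le_iff)
  have "?I \<le> ennreal (U * (b - a))"
    unfolding const[OF assms(3), symmetric]
    by (intro nn_integral_mono) (auto simp: assms ennreal_leI split: split_indicator)
  then show "\<Phi> b - \<Phi> a \<le> U * (b - a)"
    unfolding inc[symmetric] using mono assms by (simp add: ennreal_le_iff)
qed

lemma std_normal_density_le_1: "std_normal_density x \<le> 1"
proof -
  have "1 \<le> sqrt (2 * pi)" using pi_gt3 by (simp add: real_le_rsqrt)
  moreover have "exp (- x\<^sup>2 / 2) \<le> 1" by simp
  ultimately show ?thesis unfolding std_normal_density_def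
    by (smt (verit) divide_le_eq_1_pos mult_le_one divide_nonneg_nonneg exp_ge_zero)
qed

lemma std_normal_density_antimono_abs: "\<bar>x\<bar> \<le> \<bar>y\<bar> \<Longrightarrow> std_normal_density y \<le> std_normal_density x"
  unfolding std_normal_density_def by (intro mult_left_mono) (auto simp: abs_le_square_iff)

lemma std_normal_cdf_lipschitz: "a \<le> b \<Longrightarrow> \<Phi> b - \<Phi> a \<le> b - a"
  using std_normal_cdf_increment_bounds(2)[of a b 0 1] std_normal_density_le_1 by simp

lemma std_normal_cdf_increment_ge:
  assumes "a \<le> b" "\<bar>a\<bar> \<le> m" "\<bar>b\<bar> \<le> m"
  shows "std_normal_density m * (b - a) \<le> \<Phi> b - \<Phi> a"
  using std_normal_cdf_increment_bounds(1)[of a b "std_normal_density m" 1]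
    std_normal_density_le_1 std_normal_density_antimono_abs assms by fastforce

lemma std_normal_cdf_strict_mono: "a < b \<Longrightarrow> \<Phi> a < \<Phi> b"
  using std_normal_cdf_increment_ge[of a b "max \<bar>a\<bar> \<bar>b\<bar>"] normal_density_pos[of 1 0 "max \<bar>a\<bar> \<bar>b\<bar>"]
  by (smt (verit) mult_pos_pos max.cobounded1 max.cobounded2)

text \<open>Rescaling a standard normal variable. Negative \<open>s\<close> is included so that \<open>s = - 1\<close> yields the
  reflection symmetry of the standard normal law.\<close>

lemma measure_centered_normal:
  assumes "s \<noteq> 0" "A \<in> sets borel"
  shows "measure (centered_normal \<bar>s\<bar>) A = measure std_normal_distribution ((\<lambda>x. s * x) -` A)"
proof -
  have "distributed std_normal_distribution lborel (\<lambda>x. x) std_normal_density"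
    by (auto simp: distributed_def distr_id2)
  from std_normal.normal_density_affine[OF this, of s 0] assms(1)
  have "distributed std_normal_distribution lborel (\<lambda>x. s * x) (normal_density 0 \<bar>s\<bar>)"
    by simp
  then have "distr std_normal_distribution lborel (\<lambda>x. s * x) = centered_normal \<bar>s\<bar>"
    by (auto simp: distributed_def centered_normal_def)
  then have "measure (centered_normal \<bar>s\<bar>) A
      = measure (distr std_normal_distribution lborel (\<lambda>x. s * x)) A" by simp
  also have "\<dots> = measure std_normal_distribution ((\<lambda>x. s * x) -` A)"
    using assms by (subst measure_distr) auto
  finally show ?thesis .
qed

lemma std_normal_reflect:
  "A \<in> sets borel \<Longrightarrow> measure std_normal_distribution (uminus -` A) = measure std_normal_distribution A"
  using measure_centered_normal[of "-1" A] by (simp add: centered_normal_def)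

lemma isCont_std_normal_cdf: "isCont \<Phi> x"
  unfolding std_normal.isCont_cdf by (simp add: measure_def emeasure_density nn_integral_0_iff_AE AE_lborel_singleton)

lemma std_normal_cdf_minus: "\<Phi> (- x) = 1 - \<Phi> x"
proof -
  have "\<Phi> (- x) = measure std_normal_distribution (uminus -` {.. - x})"
    by (simp add: cdf_def std_normal_reflect)
  also have "uminus -` {.. - x} = {x..}" by auto
  also have "{x..} = space std_normal_distribution - {..<x}" by auto
  also have "measure std_normal_distribution \<dots> = 1 - measure std_normal_distribution {..<x}"
    by (rule std_normal.prob_compl) simp
  also have "measure std_normal_distribution {..<x} = \<Phi> x"
  proof -
    have "(\<Phi> \<longlongrightarrow> \<Phi> x) (at_left x)"
      using isCont_std_normal_cdf[of x] by (simp add: continuous_at_imp_continuous_at_within isCont_def filterlim_at_split)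
    then show ?thesis using tendsto_unique std_normal.cdf_at_left trivial_limit_at_left_real by blast
  qed
  finally show ?thesis .
qed

text \<open>For \<open>x \<ge> 0\<close> this is the probability that a standard normal variable exceeds \<open>x\<close> in absolute
  value. In terms of \<open>\<Phi>\<close> it makes sense for all \<open>x\<close>, and the equations for the thresholds read
  \<open>T c ^ n = 1 - \<alpha> / 2\<close> and \<open>(1 - T d) ^ n = 1 - \<alpha> / 2\<close>.\<close>

definition two_sided_tail :: "real \<Rightarrow> real" where
  "two_sided_tail x = 2 * (1 - \<Phi> x)"

lemma std_normal_abs_between:
  assumes "0 \<le> c" "c \<le> d"
  shows "measure std_normal_distribution {y. c < \<bar>y\<bar> \<and> \<bar>y\<bar> < d} = two_sided_tail c - two_sided_tail d"
proof (cases "c = d")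
  case False
  let ?m = "measure std_normal_distribution"
  have sing: "?m {d} = 0" using isCont_std_normal_cdf std_normal.isCont_cdf by blast
  have "{c<..d} = {c<..<d} \<union> {d}" using False assms by auto
  then have "?m {c<..d} = ?m {c<..<d} + ?m {d}"
    by (simp only:) (rule std_normal.finite_measure_Union, auto)
  then have right: "?m {c<..<d} = \<Phi> d - \<Phi> c"
    using std_normal.cdf_diff_eq[of c d] False assms sing by simp
  have "?m (uminus -` {c<..<d}) = ?m {c<..<d}" by (rule std_normal_reflect) simp
  moreover have "{y. c < \<bar>y\<bar> \<and> \<bar>y\<bar> < d} = {c<..<d} \<union> uminus -` {c<..<d}" using assms by auto
  moreover have "?m ({c<..<d} \<union> uminus -` {c<..<d}) = ?m {c<..<d} + ?m (uminus -` {c<..<d})"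
    using assms by (intro std_normal.finite_measure_Union) (auto simp: greaterThanLessThan_def)
  ultimately show ?thesis by (simp add: right two_sided_tail_def)
next
  case True
  then have "{y. c < \<bar>y\<bar> \<and> \<bar>y\<bar> < d} = {}" by auto
  then show ?thesis using True by (simp only:) simp
qed

lemma centered_normal_abs_between:
  assumes "0 < s" "0 \<le> c" "c \<le> d"
  shows "measure (centered_normal s) {y. c < \<bar>y\<bar> \<and> \<bar>y\<bar> < d}
    = two_sided_tail (c / s) - two_sided_tail (d / s)"
proof -
  have "(\<lambda>x. s * x) -` {y. c < \<bar>y\<bar> \<and> \<bar>y\<bar> < d} = {y. c / s < \<bar>y\<bar> \<and> \<bar>y\<bar> < d / s}"
    using assms by (auto simp: abs_mult field_simps)
  moreover have "{y. c < \<bar>y\<bar> \<and> \<bar>y\<bar> < d} \<in> sets borel" by measurable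
  ultimately show ?thesis
    using measure_centered_normal[of s "{y. c < \<bar>y\<bar> \<and> \<bar>y\<bar> < d}"] assms
      std_normal_abs_between[of "c / s" "d / s"] by (simp add: divide_right_mono)
qed

lemma two_sided_tail_0: "two_sided_tail 0 = 1"
  using std_normal_cdf_minus[of 0] by (simp add: two_sided_tail_def)

lemma two_sided_tail_nonneg: "0 \<le> two_sided_tail x"
  using std_normal.cdf_bounded_prob[of x] by (simp add: two_sided_tail_def)

lemma two_sided_tail_antimono: "x \<le> y \<Longrightarrow> two_sided_tail y \<le> two_sided_tail x"
  using std_normal.cdf_nondecreasing[of x y] by (simp add: two_sided_tail_def)

lemma two_sided_tail_le_1: "0 \<le> x \<Longrightarrow> two_sided_tail x \<le> 1"
  using two_sided_tail_antimono[of 0 x] two_sided_tail_0 by simp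

lemma two_sided_tail_less_iff: "two_sided_tail x < two_sided_tail y \<longleftrightarrow> y < x"
  using std_normal_cdf_strict_mono[of x y] std_normal_cdf_strict_mono[of y x]
  by (cases x y rule: linorder_cases) (auto simp: two_sided_tail_def)

lemma two_sided_tail_attains:
  assumes "0 < p" "p < 1"
  obtains x where "0 < x" "two_sided_tail x = p"
proof -
  have "(\<lambda>i. two_sided_tail (real i)) \<longlonglongrightarrow> 2 * (1 - 1)"
    unfolding two_sided_tail_def by (intro tendsto_intros std_normal.cdf_lim_infty_prob)
  then obtain i where i: "two_sided_tail (real i) < p"
    using order_tendstoD(2)[of _ 0] assms(1) by (fastforce simp: eventually_sequentially)
  have "\<exists>x\<ge>0. x \<le> real i \<and> two_sided_tail x = p"
    using i assms two_sided_tail_0 isCont_std_normal_cdf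
    by (intro IVT2) (auto simp: two_sided_tail_def)
  then show ?thesis using that two_sided_tail_0 assms by (metis less_eq_real_def less_irrefl)
qed

text \<open>Beyond \<open>x\<close>, the standard normal density is at most \<open>exp (- x\<^sup>2 / 2)\<close> times the normal density
  centered at \<open>x\<close>, which has total mass one.\<close>

lemma two_sided_tail_le_exp:
  assumes "0 \<le> x"
  shows "two_sided_tail x \<le> 2 * exp (- x\<^sup>2 / 2)"
proof -
  have "1 - \<Phi> x = measure std_normal_distribution (space std_normal_distribution - {..x})"
    by (subst std_normal.prob_compl) (auto simp: cdf_def)
  also have "space std_normal_distribution - {..x} = {x<..}" by auto
  finally have "ennreal (1 - \<Phi> x) = (\<integral>\<^sup>+y. ennreal (std_normal_density y) * indicator {x<..} y \<partial>lborel)"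
    by (simp add: std_normal.emeasure_eq_measure[symmetric] emeasure_density)
  also have "\<dots> \<le> (\<integral>\<^sup>+y. ennreal (exp (- x\<^sup>2 / 2)) * ennreal (normal_density x 1 y) \<partial>lborel)"
  proof (intro nn_integral_mono)
    fix y :: real
    have "std_normal_density y \<le> exp (- x\<^sup>2 / 2) * normal_density x 1 y" if "x < y"
    proof -
      \<comment> \<open>Completing the square: \<open>y\<^sup>2 = (y - x)\<^sup>2 + 2 * x * y - x\<^sup>2\<close>, and \<open>x * y \<ge> x\<^sup>2\<close>.\<close>
      have "- y\<^sup>2 / 2 \<le> - x\<^sup>2 / 2 - (y - x)\<^sup>2 / 2"
        using assms that mult_left_mono[of x y x]
        by (simp add: power2_diff) (simp add: power2_eq_square field_simps)
      then have "exp (- y\<^sup>2 / 2) \<le> exp (- x\<^sup>2 / 2) * exp (- (y - x)\<^sup>2 / 2)"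
        by (simp add: exp_add[symmetric])
      then show ?thesis
        by (simp add: normal_density_def divide_right_mono)
    qed
    then show "ennreal (std_normal_density y) * indicator {x<..} y
        \<le> ennreal (exp (- x\<^sup>2 / 2)) * ennreal (normal_density x 1 y)"
      by (auto simp: ennreal_mult'[symmetric] ennreal_leI split: split_indicator)
  qed
  also have "\<dots> = ennreal (exp (- x\<^sup>2 / 2))"
    by (simp add: nn_integral_cmult nn_integral_eq_integral)
  finally show ?thesis by (simp add: two_sided_tail_def)
qed

text \<open>The interval from \<open>x\<close> to \<open>1 + x\<close> alone carries this mass. The unit shift costs only a factor
  subexponential in \<open>x\<^sup>2\<close>, which suffices on the polynomial scale.\<close>

lemma two_sided_tail_ge_density:
  assumes "0 \<le> x"
  shows "std_normal_density (1 + x) \<le> two_sided_tail x"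
proof -
  have "std_normal_density (1 + x) \<le> \<Phi> (1 + x) - \<Phi> x"
    using std_normal_cdf_increment_ge[of x "1 + x" "1 + x"] assms by simp
  also have "\<dots> \<le> two_sided_tail x"
    using std_normal.cdf_bounded_prob[of "1 + x"] std_normal.cdf_bounded_prob[of x]
    by (simp add: two_sided_tail_def)
  finally show ?thesis .
qed

text \<open>Both sides are Gaussian in \<open>x\<close> up to lower order terms in the exponent, with rates
  \<open>p * a\<^sup>2 / 2\<close> and \<open>q * b\<^sup>2 / 2\<close>; the strict gap between the rates absorbs these terms. Applied in
  both directions, with \<open>{a, b} = {1, 1 / s}\<close>, it says that \<open>T (d / s)\<close> is essentially \<open>T d\<close> to
  the power \<open>1 / s\<^sup>2\<close>.\<close>

lemma two_sided_tail_power_compare: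
  assumes "0 < a" "0 < b" "0 < p" "0 < q" "q * b\<^sup>2 < p * a\<^sup>2"
  obtains K where "0 < K"
    "\<And>x. 0 \<le> x \<Longrightarrow> two_sided_tail (a * x) powr p \<le> K * two_sided_tail (b * x) powr q"
proof
  define D where "D = p * a\<^sup>2 - q * b\<^sup>2"
  \<comment> \<open>\<open>M\<close> is the maximum over \<open>x\<close> of \<open>q * (1 + b * x)\<^sup>2 - p * (a * x)\<^sup>2\<close>.\<close>
  define M where "M = q + (q * b)\<^sup>2 / D"
  define C where "C = std_normal_density 0"
  define K where "K = 2 powr p * exp (M / 2) / C powr q"
  have D: "0 < D" using assms by (simp add: D_def)
  have C: "0 < C" by (simp add: C_def normal_density_pos)
  show "0 < K" using C by (simp add: K_def)
  fix x :: real assume x: "0 \<le> x"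
  have "0 \<le> (D * x - q * b)\<^sup>2 / D" using D by simp
  also have "\<dots> = D * x\<^sup>2 - 2 * q * b * x + (q * b)\<^sup>2 / D"
    using D by (simp add: field_simps power2_eq_square)
  finally have quad: "q * (1 + b * x)\<^sup>2 \<le> p * (a * x)\<^sup>2 + M"
    by (simp add: D_def M_def power2_eq_square algebra_simps)
  have "two_sided_tail (a * x) powr p \<le> (2 * exp (- (a * x)\<^sup>2 / 2)) powr p"
    using assms x by (intro powr_mono2 two_sided_tail_le_exp two_sided_tail_nonneg) auto
  also have "\<dots> = 2 powr p * exp (- (p * (a * x)\<^sup>2) / 2)"
    by (simp add: powr_mult exp_powr_real mult.commute)
  also have "\<dots> \<le> 2 powr p * exp (M / 2 - q * (1 + b * x)\<^sup>2 / 2)"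
    using quad by (simp add: field_simps)
  also have "exp (M / 2 - q * (1 + b * x)\<^sup>2 / 2) = exp (M / 2) * exp (- (q * (1 + b * x)\<^sup>2) / 2)"
    by (simp add: exp_add[symmetric])
  also have "2 powr p * \<dots> = K * (C powr q * exp (- (q * (1 + b * x)\<^sup>2) / 2))"
    using C by (simp add: K_def)
  also have "C powr q * exp (- (q * (1 + b * x)\<^sup>2) / 2) = std_normal_density (1 + b * x) powr q"
  proof -
    have "std_normal_density (1 + b * x) = C * exp (- (1 + b * x)\<^sup>2 / 2)"
      by (simp add: C_def std_normal_density_def)
    then show ?thesis using C by (simp add: powr_mult exp_powr_real mult.commute)
  qed
  also have "K * \<dots> \<le> K * two_sided_tail (b * x) powr q"
    using assms x \<open>0 < K\<close>
    by (intro mult_left_mono powr_mono2 two_sided_tail_ge_density) auto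
  finally show "two_sided_tail (a * x) powr p \<le> K * two_sided_tail (b * x) powr q" .
qed

lemma central_mass_eq: "1 - two_sided_tail x = 2 * (\<Phi> x - \<Phi> 0)"
  using two_sided_tail_0 by (simp add: two_sided_tail_def)

lemma central_mass_le: "0 \<le> x \<Longrightarrow> 1 - two_sided_tail x \<le> 2 * x"
  using std_normal_cdf_lipschitz[of 0 x] by (simp add: central_mass_eq)

lemma central_mass_ge:
  assumes "0 \<le> x"
  shows "2 * std_normal_density 1 * min x 1 \<le> 1 - two_sided_tail x"
  using std_normal_cdf_increment_ge[of 0 "min x 1" 1] std_normal.cdf_nondecreasing[of "min x 1" x] assms
  by (simp add: central_mass_eq)

text \<open>The central mass is linear in \<open>c\<close> up to \<open>c = 1\<close> and of constant order beyond; both \<open>c / s\<close>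
  and \<open>c\<close> can therefore be compared with \<open>min c 1\<close>.\<close>

lemma central_mass_dilation:
  assumes "0 \<le> c" "0 < s" "s \<le> 1"
  shows "1 - two_sided_tail (c / s) \<le> (1 - two_sided_tail c) / (std_normal_density 1 * s)"
proof -
  let ?k = "std_normal_density 1"
  have k: "0 < ?k" by (simp add: normal_density_pos)
  have "1 - two_sided_tail (c / s) \<le> 2 * min c 1 / s"
  proof (cases "c \<le> 1")
    case True
    then show ?thesis using central_mass_le[of "c / s"] assms by simp
  next
    case False
    then have "1 \<le> 2 * min c 1 / s" using assms by simp
    then show ?thesis using two_sided_tail_nonneg[of "c / s"] by linarith
  qed
  also have "\<dots> = 2 * ?k * min c 1 / (?k * s)" using k by simp
  also have "\<dots> \<le> (1 - two_sided_tail c) / (?k * s)"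
    using central_mass_ge[of c] assms k by (intro divide_right_mono) auto
  finally show ?thesis .
qed

section \<open>The thresholds and the risk of the extremes test\<close>

lemma min_threshold_eqI:
  assumes "1 \<le> n" "two_sided_tail c ^ n = 1 - \<alpha> / 2"
  shows "min_threshold n \<alpha> = c"
  unfolding min_threshold_def
proof (rule the_equality)
  show "(2 * (1 - \<Phi> c)) ^ n = 1 - \<alpha> / 2"
    using assms by (simp add: two_sided_tail_def)
  fix c' assume "(2 * (1 - \<Phi> c')) ^ n = 1 - \<alpha> / 2"
  then have "two_sided_tail c' ^ n = two_sided_tail c ^ n"
    using assms by (simp add: two_sided_tail_def)
  then have "two_sided_tail c' = two_sided_tail c"
    using assms two_sided_tail_nonneg by (subst (asm) power_eq_iff_eq_base) auto
  then show "c' = c"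
    using two_sided_tail_less_iff by (metis less_irrefl linorder_neqE)
qed

lemma max_threshold_eqI:
  assumes "1 \<le> n" "0 \<le> d" "(1 - two_sided_tail d) ^ n = 1 - \<alpha> / 2"
  shows "max_threshold n \<alpha> = d"
  unfolding max_threshold_def
proof (rule the_equality)
  show "0 \<le> d \<and> (2 * \<Phi> d - 1) ^ n = 1 - \<alpha> / 2"
    using assms by (simp add: two_sided_tail_def algebra_simps)
  fix d' assume d': "0 \<le> d' \<and> (2 * \<Phi> d' - 1) ^ n = 1 - \<alpha> / 2"
  then have "(1 - two_sided_tail d') ^ n = (1 - two_sided_tail d) ^ n"
    using assms by (simp add: two_sided_tail_def algebra_simps)
  then have "1 - two_sided_tail d' = 1 - two_sided_tail d"
    using assms d' two_sided_tail_le_1 by (subst (asm) power_eq_iff_eq_base) auto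
  then show "d' = d"
    using two_sided_tail_less_iff by (metis less_irrefl linorder_neqE add_diff_cancel_left' diff_diff_eq2 diff_add_cancel)
qed

text \<open>Both thresholds are quantiles at the common probability
  \<open>\<delta> = 1 - (1 - \<alpha> / 2) powr (1 / n)\<close>, which is of order \<open>\<alpha> / n\<close>. As \<open>\<delta> \<le> 1 / 2\<close>, the acceptance
  interval is never inverted.\<close>

lemma thresholds:
  assumes "1 \<le> n" "0 < \<alpha>" "\<alpha> < 1"
  obtains \<delta> c d where "min_threshold n \<alpha> = c" "max_threshold n \<alpha> = d"
    "0 \<le> c" "c \<le> d" "two_sided_tail c = 1 - \<delta>" "two_sided_tail d = \<delta>"
    "\<alpha> / 2 \<le> real n * \<delta>" "real n * \<delta> \<le> \<alpha>" "0 < \<delta>" "\<delta> \<le> 1 / 2"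
proof -
  define \<delta> where "\<delta> = 1 - root n (1 - \<alpha> / 2)"
  have pow: "(1 - \<delta>) ^ n = 1 - \<alpha> / 2"
    using assms by (simp add: \<delta>_def)
  have \<delta>0: "0 < \<delta>" and \<delta>1: "\<delta> < 1"
    using assms by (simp_all add: \<delta>_def)
  have "(1 - \<delta>) ^ n \<le> (1 - \<delta>) ^ 1"
    using \<delta>0 \<delta>1 assms by (intro power_decreasing) auto
  then have half: "\<delta> \<le> 1 / 2" using pow assms by simp
  have lower: "\<alpha> / 2 \<le> real n * \<delta>"
    using Bernoulli_inequality[of "- \<delta>" n] \<delta>1 pow by simp
  \<comment> \<open>Bernoulli's inequality for \<open>(1 + \<delta>) ^ n\<close> yields the upper bound
    \<open>(1 - \<delta>) ^ n \<le> 1 / (1 + n * \<delta>)\<close>.\<close>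
  have "(1 - \<delta>) ^ n * (1 + real n * \<delta>) \<le> (1 - \<delta>) ^ n * (1 + \<delta>) ^ n"
    using Bernoulli_inequality[of \<delta> n] \<delta>0 \<delta>1 by (intro mult_left_mono) auto
  also have "\<dots> = (1 - \<delta>\<^sup>2) ^ n"
    by (simp add: power_mult_distrib[symmetric] algebra_simps power2_eq_square)
  also have "\<dots> \<le> 1"
    using \<delta>0 \<delta>1 by (intro power_le_one) (auto simp: power_le_one)
  finally have "real n * \<delta> * (1 - \<alpha> / 2) \<le> \<alpha> / 2"
    unfolding pow by (simp add: algebra_simps)
  moreover have "real n * \<delta> * (1 / 2) \<le> real n * \<delta> * (1 - \<alpha> / 2)"
    using assms \<delta>0 by (intro mult_left_mono) auto
  ultimately have upper: "real n * \<delta> \<le> \<alpha>" by linarith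
  obtain c where c: "0 < c" "two_sided_tail c = 1 - \<delta>"
    using two_sided_tail_attains[of "1 - \<delta>"] \<delta>0 \<delta>1 by auto
  obtain d where d: "0 < d" "two_sided_tail d = \<delta>"
    using two_sided_tail_attains[of \<delta>] \<delta>0 \<delta>1 by auto
  have "c \<le> d"
    using two_sided_tail_less_iff[of c d] c d half by linarith
  show thesis
  proof
    show "min_threshold n \<alpha> = c" using assms c pow by (intro min_threshold_eqI) auto
    show "max_threshold n \<alpha> = d" using assms d pow by (intro max_threshold_eqI) auto
  qed (use c d \<open>c \<le> d\<close> lower upper \<delta>0 half in auto)
qed

lemma prob_space_centered_normal: "0 < s \<Longrightarrow> prob_space (centered_normal s)"
  unfolding centered_normal_def by (rule prob_space_normal_density)

lemma prob_space_normal_mixture: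
  assumes "0 \<le> e" "e \<le> 1" "0 < s"
  shows "prob_space (normal_mixture e s)"
proof
  have "emeasure (centered_normal r) UNIV = 1" if "0 < r" for r
    using prob_space.emeasure_space_1[OF prob_space_centered_normal[OF that]]
    by (simp add: centered_normal_def)
  then have "emeasure (normal_mixture e s) UNIV = 1"
    using assms by (simp add: emeasure_normal_mixture ennreal_plus[symmetric] del: ennreal_plus)
  then show "emeasure (normal_mixture e s) (space (normal_mixture e s)) = 1"
    by (simp add: normal_mixture_def)
qed

lemma normal_mixture_abs_between:
  assumes "0 \<le> e" "e \<le> 1" "0 < s" "0 \<le> c" "c \<le> d"
  shows "measure (normal_mixture e s) {y. c < \<bar>y\<bar> \<and> \<bar>y\<bar> < d}
    = (1 - e) * (two_sided_tail c - two_sided_tail d)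
      + e * (two_sided_tail (c / s) - two_sided_tail (d / s))"
proof -
  let ?A = "{y. c < \<bar>y\<bar> \<and> \<bar>y\<bar> < d}"
  have "?A \<in> sets borel" by measurable
  then have "emeasure (normal_mixture e s) ?A
    = ennreal (1 - e) * emeasure (centered_normal 1) ?A + ennreal e * emeasure (centered_normal s) ?A"
    using assms by (intro emeasure_normal_mixture) auto
  also have "\<dots> = ennreal ((1 - e) * measure (centered_normal 1) ?A + e * measure (centered_normal s) ?A)"
    using assms by (simp add: prob_space_centered_normal prob_space.finite_measure
        finite_measure.emeasure_eq_measure ennreal_mult ennreal_plus)
  finally have "measure (normal_mixture e s) ?A
      = (1 - e) * measure (centered_normal 1) ?A + e * measure (centered_normal s) ?A"
    using assms by (intro measure_eq_emeasure_eq_ennreal) auto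
  then show ?thesis
    using assms centered_normal_abs_between[of 1 c d] centered_normal_abs_between[of s c d] by simp
qed

lemma prob_extremes_test_accepts:
  assumes P: "prob_space P" "sets P = sets borel" and "1 \<le> n"
  shows "extremes_test n \<alpha> \<in> sets (iid_sample n P)"
    and "measure (iid_sample n P) (space (iid_sample n P) - extremes_test n \<alpha>)
      = measure P {y. min_threshold n \<alpha> < \<bar>y\<bar> \<and> \<bar>y\<bar> < max_threshold n \<alpha>} ^ n"
proof -
  let ?A = "{y. min_threshold n \<alpha> < \<bar>y\<bar> \<and> \<bar>y\<bar> < max_threshold n \<alpha>}"
  have A: "?A \<in> sets P" unfolding P(2) by measurable
  have spc: "space (iid_sample n P) = {1..n} \<rightarrow>\<^sub>E UNIV"
    using sets_eq_imp_space_eq[OF P(2)] by (simp add: iid_sample_def space_PiM)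
  have acc: "space (iid_sample n P) - extremes_test n \<alpha> = (\<Pi>\<^sub>E i\<in>{1..n}. ?A)"
    unfolding spc extremes_test_def using assms(3)
    by (auto simp: PiE_def Pi_def extensional_def not_le Min_le_iff Max_ge_iff)
  interpret finite_product_prob_space "\<lambda>_. P" "{1..n}"
    using P(1)
    by (simp add: finite_product_prob_space_def product_prob_space_def
        product_prob_space_axioms_def finite_product_sigma_finite_def
        finite_product_sigma_finite_axioms_def product_sigma_finite_def prob_space_imp_sigma_finite)
  have "extremes_test n \<alpha> = space (iid_sample n P) - (\<Pi>\<^sub>E i\<in>{1..n}. ?A)"
    unfolding acc[symmetric] by (auto simp: spc extremes_test_def)
  also have "\<dots> \<in> sets (iid_sample n P)"
    unfolding iid_sample_def using A by (intro sets.compl_sets sets_PiM_I_finite) auto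
  finally show "extremes_test n \<alpha> \<in> sets (iid_sample n P)" .
  show "measure (iid_sample n P) (space (iid_sample n P) - extremes_test n \<alpha>) = measure P ?A ^ n"
    unfolding acc unfolding iid_sample_def using A by (subst prob_times) auto
qed

lemma risk_extremes_test:
  assumes "1 \<le> n" "0 \<le> e" "e \<le> 1" "0 < s"
    and "0 \<le> c" "c \<le> d" "min_threshold n \<alpha> = c" "max_threshold n \<alpha> = d"
  shows "risk (H0 n) (H1 e s n) (extremes_test n \<alpha>) =
    1 - (two_sided_tail c - two_sided_tail d) ^ n
    + ((1 - e) * (two_sided_tail c - two_sided_tail d)
       + e * (two_sided_tail (c / s) - two_sided_tail (d / s))) ^ n"
proof -
  have std: "prob_space (centered_normal 1)" "sets (centered_normal 1) = sets borel"
    using prob_space_centered_normal[of 1] by (auto simp: centered_normal_def)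
  have mix: "prob_space (normal_mixture e s)" "sets (normal_mixture e s) = sets borel"
    using prob_space_normal_mixture assms by (auto simp: normal_mixture_def)
  interpret H0: prob_space "H0 n"
    unfolding H0_def iid_sample_def using std(1) by (intro prob_space_PiM)
  have "measure (H0 n) (space (H0 n) - extremes_test n \<alpha>) = 1 - measure (H0 n) (extremes_test n \<alpha>)"
    using prob_extremes_test_accepts(1)[OF std assms(1)] by (intro H0.prob_compl) (simp add: H0_def)
  then show ?thesis
    using prob_extremes_test_accepts(2)[OF std assms(1), of \<alpha>] prob_extremes_test_accepts(2)[OF mix assms(1), of \<alpha>]
      centered_normal_abs_between[of 1 c d] normal_mixture_abs_between[of e s c d] assms
    by (simp add: risk_def H0_def H1_def)
qed

section \<open>The expected number of extreme effects controls the risk\<close>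

text \<open>The probability that a single draw from the centered normal law with standard deviation \<open>s\<close>
  is extreme, that is, small or large enough in absolute value to make the test reject.\<close>

definition extreme_mass :: "nat \<Rightarrow> real \<Rightarrow> real \<Rightarrow> real" where
  "extreme_mass n \<alpha> s =
     (1 - two_sided_tail (min_threshold n \<alpha> / s)) + two_sided_tail (max_threshold n \<alpha> / s)"

text \<open>A single observation is accepted with probability \<open>1 - 2 * \<delta>\<close> under the null hypothesis and
  \<open>m\<close> under the alternative, and the risk is \<open>1 - (1 - 2 * \<delta>) ^ n + m ^ n\<close>. From below, the
  difference of powers is Lipschitz with constant \<open>n\<close>, and \<open>(1 - 2 * \<delta>) - m\<close> is at most \<open>e\<close> times
  the extreme mass. From above, the error of the first kind is at most \<open>2 * n * \<delta>\<close>, and \<open>m\<close> is at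
  most one minus \<open>e\<close> times the extreme mass.\<close>

lemma risk_bounds:
  assumes "1 \<le> n" "0 < \<alpha>" "\<alpha> < 1" "0 \<le> e" "e \<le> 1" "0 < s"
  shows "1 - real n * e * extreme_mass n \<alpha> s \<le> risk (H0 n) (H1 e s n) (extremes_test n \<alpha>)"
    and "risk (H0 n) (H1 e s n) (extremes_test n \<alpha>) \<le> 2 * \<alpha> + exp (- (real n * e * extreme_mass n \<alpha> s))"
proof -
  obtain \<delta> c d where cd: "min_threshold n \<alpha> = c" "max_threshold n \<alpha> = d" "0 \<le> c" "c \<le> d"
    and T: "two_sided_tail c = 1 - \<delta>" "two_sided_tail d = \<delta>"
    and \<delta>: "real n * \<delta> \<le> \<alpha>" "0 < \<delta>" "\<delta> \<le> 1 / 2"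
    using thresholds[OF assms(1-3)] by metis
  define t where "t = extreme_mass n \<alpha> s"
  define m where "m = (1 - e) * (1 - 2 * \<delta>) + e * (1 - t)"
  have t0: "0 \<le> t" and t1: "t \<le> 1"
    using two_sided_tail_le_1[of "c / s"] two_sided_tail_nonneg[of "d / s"]
      two_sided_tail_antimono[of "c / s" "d / s"] cd assms
    by (auto simp: t_def extreme_mass_def divide_right_mono)
  have m0: "0 \<le> m" using assms \<delta> t1 by (simp add: m_def)
  have m_diff: "(1 - 2 * \<delta>) - m = e * (t - 2 * \<delta>)" by (simp add: m_def algebra_simps)
  have "(1 - e) * (1 - 2 * \<delta>) \<le> 1 - e"
    using assms \<delta> by (intro mult_right_le_one_le) auto
  then have m_le: "m \<le> 1 - e * t" by (simp add: m_def algebra_simps)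
  have risk: "risk (H0 n) (H1 e s n) (extremes_test n \<alpha>) = 1 - (1 - 2 * \<delta>) ^ n + m ^ n"
    using risk_extremes_test[OF assms(1,4-6) cd(3,4,1,2)] T cd
    by (simp add: m_def t_def extreme_mass_def algebra_simps)

  have "(1 - 2 * \<delta>) ^ n - m ^ n \<le> real n * (e * t)"
  proof (cases "m \<le> 1 - 2 * \<delta>")
    case True
    have "(1 - 2 * \<delta>) ^ n - m ^ n \<le> real n * \<bar>(1 - 2 * \<delta>) - m\<bar>"
      using norm_power_diff[of "1 - 2 * \<delta>" m n] \<delta> m0 True by simp
    also have "\<dots> = real n * (e * (t - 2 * \<delta>))" using True m_diff by simp
    also have "\<dots> \<le> real n * (e * t)" using \<delta> assms by (intro mult_left_mono) auto
    finally show ?thesis .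
  next
    case False
    then have "(1 - 2 * \<delta>) ^ n \<le> m ^ n" using \<delta> by (intro power_mono) auto
    moreover have "0 \<le> real n * (e * t)" using assms t0 by simp
    ultimately show ?thesis by linarith
  qed
  then show "1 - real n * e * extreme_mass n \<alpha> s \<le> risk (H0 n) (H1 e s n) (extremes_test n \<alpha>)"
    unfolding risk t_def[symmetric] by (simp add: algebra_simps)

  have "1 - real n * (2 * \<delta>) \<le> (1 - 2 * \<delta>) ^ n"
    using Bernoulli_inequality[of "- (2 * \<delta>)" n] \<delta> by simp
  then have type1: "1 - (1 - 2 * \<delta>) ^ n \<le> 2 * \<alpha>" using \<delta> by simp
  have "m ^ n \<le> exp (- (e * t)) ^ n"
    using m0 m_le exp_ge_add_one_self[of "- (e * t)"] by (intro power_mono) auto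
  also have "\<dots> = exp (- (real n * e * t))"
    by (simp add: exp_of_nat_mult[symmetric] mult.assoc)
  finally show "risk (H0 n) (H1 e s n) (extremes_test n \<alpha>) \<le> 2 * \<alpha> + exp (- (real n * e * extreme_mass n \<alpha> s))"
    unfolding risk t_def[symmetric] using type1 by simp
qed

text \<open>Shrinking the standard deviation below \<open>1\<close> only lightens the tail, and it increases the
  central mass by at most a factor of order \<open>1 / s\<close>; under the null both masses equal
  \<open>\<delta> \<le> 1 / n\<close>.\<close>

lemma extreme_mass_le_narrow:
  assumes "1 \<le> n" "0 < \<alpha>" "\<alpha> < 1" "0 < s" "s \<le> 1"
  shows "real n * extreme_mass n \<alpha> s \<le> (1 / std_normal_density 1 + 1) / s"
proof -
  obtain \<delta> c d where cd: "min_threshold n \<alpha> = c" "max_threshold n \<alpha> = d" "0 \<le> c" "c \<le> d"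
    and T: "two_sided_tail c = 1 - \<delta>" "two_sided_tail d = \<delta>"
    and \<delta>: "real n * \<delta> \<le> \<alpha>" "0 < \<delta>"
    using thresholds[OF assms(1-3)] by metis
  define k where "k = 1 / std_normal_density 1"
  have k: "0 < k" by (simp add: k_def normal_density_pos)
  have "1 - two_sided_tail (c / s) \<le> k * \<delta> / s"
    using central_mass_dilation[of c s] cd assms T by (simp add: k_def)
  moreover have "two_sided_tail (d / s) \<le> \<delta>"
    using two_sided_tail_antimono[of d "d / s"] cd assms T by (simp add: field_simps mult_left_le)
  moreover have "\<delta> \<le> \<delta> / s" using assms \<delta> by (simp add: field_simps)
  ultimately have "extreme_mass n \<alpha> s \<le> (k + 1) / s * \<delta>"
    by (simp add: extreme_mass_def cd add_divide_distrib algebra_simps)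
  then have "real n * extreme_mass n \<alpha> s \<le> real n * ((k + 1) / s * \<delta>)"
    by (rule mult_left_mono) simp
  also have "\<dots> = (k + 1) / s * (real n * \<delta>)" by simp
  also have "\<dots> \<le> (k + 1) / s * 1"
    using \<delta> assms k by (intro mult_left_mono) auto
  finally show ?thesis by (simp add: k_def)
qed

text \<open>Stretching only lowers the central mass, and the tail mass becomes at most a constant times
  \<open>\<delta> powr \<theta>\<close>, where \<open>\<delta> \<le> 1 / n\<close>. The constant \<open>K\<close> does not depend on the level, as is needed
  for a statement about every choice of levels.\<close>

lemma extreme_mass_le_wide:
  assumes "1 \<le> s" "0 < \<theta>" "\<theta> < 1 / s\<^sup>2"
  obtains K where "\<And>n \<alpha>. 1 \<le> n \<Longrightarrow> 0 < \<alpha> \<Longrightarrow> \<alpha> < 1 \<Longrightarrow> extreme_mass n \<alpha> s \<le> K * real n powr - \<theta>"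
proof -
  obtain K where K: "0 < K"
    "\<And>x. 0 \<le> x \<Longrightarrow> two_sided_tail (1 / s * x) powr 1 \<le> K * two_sided_tail (1 * x) powr \<theta>"
    using two_sided_tail_power_compare[of "1 / s" 1 1 \<theta>] assms by (auto simp: power_divide)
  have "1 / s\<^sup>2 \<le> 1" using assms by simp
  then have \<theta>1: "\<theta> \<le> 1" using assms by linarith
  show ?thesis
  proof
    fix n :: nat and \<alpha> :: real assume n: "1 \<le> n" and \<alpha>: "0 < \<alpha>" "\<alpha> < 1"
    obtain \<delta> c d where cd: "min_threshold n \<alpha> = c" "max_threshold n \<alpha> = d" "0 \<le> c" "c \<le> d"
      and T: "two_sided_tail c = 1 - \<delta>" "two_sided_tail d = \<delta>"
      and \<delta>: "real n * \<delta> \<le> \<alpha>" "0 < \<delta>"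
      using thresholds[OF n \<alpha>] by metis
    have \<delta>n: "\<delta> \<le> 1 / real n" using \<delta> \<alpha> n by (simp add: field_simps)
    have "two_sided_tail c \<le> two_sided_tail (c / s)"
      using cd assms mult_left_mono[of 1 s c]
      by (intro two_sided_tail_antimono) (simp add: field_simps)
    then have "1 - two_sided_tail (c / s) \<le> real n powr - 1"
      using T \<delta>n n by (simp add: powr_minus_divide)
    also have "\<dots> \<le> real n powr - \<theta>" using n \<theta>1 by (intro powr_mono) auto
    finally have center: "1 - two_sided_tail (c / s) \<le> real n powr - \<theta>" .
    have "two_sided_tail (d / s) \<le> K * \<delta> powr \<theta>"
      using K(2)[of d] cd T two_sided_tail_nonneg[of "d / s"] by (simp add: powr_one_gt_zero_iff)
    also have "\<dots> \<le> K * (1 / real n) powr \<theta>"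
      using K(1) \<delta>n \<delta> assms by (intro mult_left_mono powr_mono2) auto
    also have "(1 / real n) powr \<theta> = real n powr - \<theta>"
      using n by (simp add: powr_divide powr_minus_divide)
    finally show "extreme_mass n \<alpha> s \<le> (1 + K) * real n powr - \<theta>"
      using center by (simp add: extreme_mass_def cd algebra_simps)
  qed
qed

text \<open>As \<open>1 - T c = \<delta>\<close> is at most \<open>2 * c\<close>, the lower threshold \<open>c\<close> is at least
  \<open>\<delta> / 2\<close>, and the central mass at \<open>c / s\<close> is at least linear up to saturation.\<close>

lemma extreme_mass_ge_central:
  assumes "1 \<le> n" "0 < \<alpha>" "\<alpha> < 1" "0 < s"
  shows "2 * std_normal_density 1 * min (\<alpha> / (4 * real n * s)) 1 \<le> extreme_mass n \<alpha> s"
proof -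
  obtain \<delta> c d where cd: "min_threshold n \<alpha> = c" "0 \<le> c"
    and T: "two_sided_tail c = 1 - \<delta>" and \<delta>: "\<alpha> / 2 \<le> real n * \<delta>"
    using thresholds[OF assms(1-3)] by metis
  have "\<alpha> / (4 * real n) \<le> \<delta> / 2" using \<delta> assms by (simp add: field_simps)
  also have "\<dots> \<le> c" using central_mass_le[of c] T cd by simp
  finally have "\<alpha> / (4 * real n * s) \<le> c / s"
    using assms by (simp add: field_simps)
  then have "2 * std_normal_density 1 * min (\<alpha> / (4 * real n * s)) 1 \<le> 2 * std_normal_density 1 * min (c / s) 1"
    by (intro mult_left_mono) auto
  also have "\<dots> \<le> 1 - two_sided_tail (c / s)"
    using central_mass_ge[of "c / s"] cd assms by simp
  also have "\<dots> \<le> extreme_mass n \<alpha> s"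
    using two_sided_tail_nonneg by (simp add: extreme_mass_def cd)
  finally show ?thesis .
qed

text \<open>Here the comparison of tails is used in the direction
  \<open>\<delta> powr \<theta> = T d powr \<theta> \<le> K * T (d / s)\<close>.\<close>

lemma extreme_mass_ge_tail:
  assumes "0 < s" "1 / s\<^sup>2 < \<theta>"
  obtains K where "0 < K"
    "\<And>n \<alpha>. 1 \<le> n \<Longrightarrow> 0 < \<alpha> \<Longrightarrow> \<alpha> < 1 \<Longrightarrow> K * (\<alpha> / (2 * real n)) powr \<theta> \<le> extreme_mass n \<alpha> s"
proof -
  have "0 < 1 / s\<^sup>2" using assms by simp
  then have \<theta>: "0 < \<theta>" using assms by linarith
  obtain K where K: "0 < K"
    "\<And>x. 0 \<le> x \<Longrightarrow> two_sided_tail (1 * x) powr \<theta> \<le> K * two_sided_tail (1 / s * x) powr 1"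
    using two_sided_tail_power_compare[of 1 "1 / s" \<theta> 1] assms \<theta> by (auto simp: power_divide)
  show ?thesis
  proof
    show "0 < 1 / K" using K by simp
    fix n :: nat and \<alpha> :: real assume n: "1 \<le> n" and \<alpha>: "0 < \<alpha>" "\<alpha> < 1"
    obtain \<delta> c d where cd: "min_threshold n \<alpha> = c" "max_threshold n \<alpha> = d" "0 \<le> c" "c \<le> d"
      and T: "two_sided_tail d = \<delta>" and \<delta>: "\<alpha> / 2 \<le> real n * \<delta>"
      using thresholds[OF n \<alpha>] by metis
    have "(\<alpha> / (2 * real n)) powr \<theta> \<le> \<delta> powr \<theta>"
      using \<delta> n \<alpha> \<theta> by (intro powr_mono2) (auto simp: field_simps)
    also have "\<dots> \<le> K * two_sided_tail (d / s)"
      using K(2)[of d] cd T two_sided_tail_nonneg[of "d / s"] by simp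
    finally have "1 / K * (\<alpha> / (2 * real n)) powr \<theta> \<le> two_sided_tail (d / s)"
      using K(1) by (simp add: field_simps)
    also have "\<dots> \<le> extreme_mass n \<alpha> s"
      using two_sided_tail_le_1[of "c / s"] cd assms by (simp add: extreme_mass_def)
    finally show "1 / K * (\<alpha> / (2 * real n)) powr \<theta> \<le> extreme_mass n \<alpha> s" .
  qed
qed

lemma asymptotically_powerful_if_many_extreme:
  assumes "\<And>n. 0 < \<alpha> n \<and> \<alpha> n < 1" "\<alpha> \<longlonglongrightarrow> 0"
    and "\<And>n. 1 \<le> n \<Longrightarrow> 0 \<le> \<epsilon> n \<and> \<epsilon> n \<le> 1" "\<And>n. 1 \<le> n \<Longrightarrow> 0 < \<sigma> n"
    and "filterlim (\<lambda>n. real n * \<epsilon> n * extreme_mass n (\<alpha> n) (\<sigma> n)) at_top sequentially"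
  shows "asymptotically_powerful H0 (\<lambda>n. H1 (\<epsilon> n) (\<sigma> n) n) (\<lambda>n. extremes_test n (\<alpha> n))"
  unfolding asymptotically_powerful_def
proof (rule tendsto_sandwich[OF _ _ tendsto_const])
  let ?u = "\<lambda>n. 2 * \<alpha> n + exp (- (real n * \<epsilon> n * extreme_mass n (\<alpha> n) (\<sigma> n)))"
  have "((\<lambda>n. exp (- (real n * \<epsilon> n * extreme_mass n (\<alpha> n) (\<sigma> n)))) \<longlongrightarrow> 0) sequentially"
    using assms(5) by (intro filterlim_compose[OF exp_at_bot]) (simp add: filterlim_uminus_at_top)
  then show "?u \<longlonglongrightarrow> 0"
    using tendsto_add[OF tendsto_mult[OF tendsto_const assms(2)]] by fastforce
  show "\<forall>\<^sub>F n in sequentially. risk (H0 n) (H1 (\<epsilon> n) (\<sigma> n) n) (extremes_test n (\<alpha> n)) \<le> ?u n"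
    using eventually_ge_at_top[of "1::nat"]
    by eventually_elim (intro risk_bounds(2), use assms in auto)
  show "\<forall>\<^sub>F n in sequentially. 0 \<le> risk (H0 n) (H1 (\<epsilon> n) (\<sigma> n) n) (extremes_test n (\<alpha> n))"
    by (simp add: risk_def)
qed

lemma asymptotically_powerless_if_few_extreme:
  assumes "\<And>n. 0 < \<alpha> n \<and> \<alpha> n < 1"
    and "\<And>n. 1 \<le> n \<Longrightarrow> 0 \<le> \<epsilon> n \<and> \<epsilon> n \<le> 1" "\<And>n. 1 \<le> n \<Longrightarrow> 0 < \<sigma> n"
    and "\<And>n. 1 \<le> n \<Longrightarrow> real n * \<epsilon> n * extreme_mass n (\<alpha> n) (\<sigma> n) \<le> u n" "u \<longlonglongrightarrow> 0"
  shows "asymptotically_powerless H0 (\<lambda>n. H1 (\<epsilon> n) (\<sigma> n) n) (\<lambda>n. extremes_test n (\<alpha> n))"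
  unfolding asymptotically_powerless_def
proof -
  let ?r = "\<lambda>n. risk (H0 n) (H1 (\<epsilon> n) (\<sigma> n) n) (extremes_test n (\<alpha> n))"
  have "(\<lambda>n. ereal (1 - u n)) \<longlonglongrightarrow> ereal (1 - 0)"
    by (intro tendsto_intros assms)
  then have "liminf (\<lambda>n. ereal (1 - u n)) = 1"
    by (simp add: lim_imp_Liminf one_ereal_def)
  moreover have "liminf (\<lambda>n. ereal (1 - u n)) \<le> liminf (\<lambda>n. ereal (?r n))"
  proof (rule Liminf_mono)
    show "\<forall>\<^sub>F n in sequentially. ereal (1 - u n) \<le> ereal (?r n)"
      using eventually_ge_at_top[of "1::nat"]
    proof eventually_elim
      case (elim n)
      then have "1 - real n * \<epsilon> n * extreme_mass n (\<alpha> n) (\<sigma> n) \<le> ?r n"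
        using assms by (intro risk_bounds(1)) auto
      then show ?case using assms(4)[OF elim] by simp
    qed
  qed
  ultimately show "1 \<le> liminf (\<lambda>n. ereal (?r n))" by simp
qed

section \<open>Detection boundary of the extremes test\<close>

text \<open>Levels decaying like a negative power of \<open>n\<close> suffice for both regimes. The factor
  \<open>n powr (1 - \<beta>)\<close> is the expected number of effects.\<close>

lemma powerful_if_power_growth:
  fixes \<beta> \<kappa> k r :: real
  assumes pos: "0 < \<beta>" "0 < \<kappa>" "0 < k" "0 < r"
    and \<epsilon>: "\<And>n. n \<ge> 1 \<Longrightarrow> \<epsilon> n = real n powr (- \<beta>)"
    and \<sigma>: "\<And>n. n \<ge> 1 \<Longrightarrow> 0 < \<sigma> n"
    and growth: "\<And>n. n \<ge> 1 \<Longrightarrow>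
      k * real n powr r \<le> real n powr (1 - \<beta>) * extreme_mass n (real n powr (- \<kappa>) / 2) (\<sigma> n)"
  shows "extremes_test_powerful \<epsilon> \<sigma>"
proof -
  \<comment> \<open>Powers of \<open>0\<close> vanish, so the level at \<open>n = 0\<close> has to be chosen separately.\<close>
  define \<alpha> where "\<alpha> n = real (max 1 n) powr (- \<kappa>) / 2" for n :: nat
  have \<alpha>01: "0 < \<alpha> n \<and> \<alpha> n < 1" for n
    using powr_mono[of "- \<kappa>" 0 "real (max 1 n)"] pos by (simp add: \<alpha>_def)
  have "asymptotically_powerful H0 (\<lambda>n. H1 (\<epsilon> n) (\<sigma> n) n) (\<lambda>n. extremes_test n (\<alpha> n))"
  proof (rule asymptotically_powerful_if_many_extreme)
    show "0 < \<alpha> n \<and> \<alpha> n < 1" for n by (rule \<alpha>01)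
    show "\<alpha> \<longlonglongrightarrow> 0" unfolding \<alpha>_def using pos by real_asymp
    show "0 \<le> \<epsilon> n \<and> \<epsilon> n \<le> 1" if "1 \<le> n" for n
      using powr_mono[of "- \<beta>" 0 "real n"] that pos by (simp add: \<epsilon>)
    show "0 < \<sigma> n" if "1 \<le> n" for n using that by (rule \<sigma>)
    show "filterlim (\<lambda>n. real n * \<epsilon> n * extreme_mass n (\<alpha> n) (\<sigma> n)) at_top sequentially"
    proof (rule filterlim_at_top_mono)
      show "filterlim (\<lambda>n. k * real n powr r) at_top sequentially"
        using pos by real_asymp
      show "\<forall>\<^sub>F n in sequentially. k * real n powr r \<le> real n * \<epsilon> n * extreme_mass n (\<alpha> n) (\<sigma> n)"
        using eventually_ge_at_top[of "1::nat"]
      proof eventually_elim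
        case (elim n)
        have "real n * \<epsilon> n = real n powr (1 - \<beta>)"
          using elim by (simp add: \<epsilon> powr_diff powr_minus_divide)
        then show ?case using growth[OF elim] elim by (simp add: \<alpha>_def max_absorb2)
      qed
    qed
  qed
  then show ?thesis using \<alpha>01 by (auto simp: extremes_test_powerful_def)
qed

lemma powerful_narrow:
  fixes \<beta> \<gamma> :: real
  assumes \<beta>: "0 < \<beta>" "\<beta> < 1" and "\<beta> < \<gamma>"
    and \<epsilon>: "\<And>n. n \<ge> 1 \<Longrightarrow> \<epsilon> n = real n powr (- \<beta>)"
    and \<sigma>: "\<And>n. n \<ge> 1 \<Longrightarrow> \<sigma> n = real n powr (- \<gamma>)"
  shows "extremes_test_powerful \<epsilon> \<sigma>"
proof -
  \<comment> \<open>With level \<open>n powr - \<kappa> / 2\<close> the expected number of extreme effects is at least of order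
    \<open>n powr (\<gamma> - \<beta> - \<kappa>)\<close> or \<open>n powr (1 - \<beta>)\<close>, whichever is smaller; halving \<open>\<gamma> - \<beta>\<close> keeps the
    first exponent positive.\<close>
  define \<kappa> where "\<kappa> = (\<gamma> - \<beta>) / 2"
  define k where "k = 2 * std_normal_density 1"
  define r where "r = min \<kappa> (1 - \<beta>)"
  have \<kappa>: "0 < \<kappa>" and r: "0 < r" using assms by (auto simp: \<kappa>_def r_def)
  have k: "0 < k" by (simp add: k_def normal_density_pos)
  show ?thesis
  proof (rule powerful_if_power_growth[where \<kappa> = \<kappa> and k = "k / 8" and r = r])
    show "0 < \<sigma> n" if "1 \<le> n" for n using that by (simp add: \<sigma>)
    fix n :: nat assume elim: "1 \<le> n"
    then have n: "1 \<le> real n" by simp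
    have pos: "0 < \<sigma> n" using elim by (simp add: \<sigma>)
    let ?\<alpha> = "real n powr (- \<kappa>) / 2"
    have \<alpha>01: "0 < ?\<alpha>" "?\<alpha> < 1"
      using powr_mono[of "- \<kappa>" 0 "real n"] \<kappa> n by simp_all
    have "real n powr (1 - \<beta>) * (?\<alpha> / (4 * real n * \<sigma> n)) = real n powr \<kappa> / 8"
    proof -
      have "real n powr (1 - \<beta>) * (?\<alpha> / (4 * real n * \<sigma> n))
        = real n powr (1 - \<beta>) * real n powr (- \<kappa>) * real n powr - 1 * real n powr \<gamma> / 8"
        using n by (simp add: \<sigma>[OF elim] powr_minus_divide)
      also have "\<dots> = real n powr (1 - \<beta> - \<kappa> - 1 + \<gamma>) / 8"
        by (simp only: powr_add[symmetric]) simp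
      finally show ?thesis by (simp add: \<kappa>_def field_simps)
    qed
    moreover have "real n powr (1 - \<beta>) * min (?\<alpha> / (4 * real n * \<sigma> n)) 1
        = min (real n powr (1 - \<beta>) * (?\<alpha> / (4 * real n * \<sigma> n))) (real n powr (1 - \<beta>) * 1)"
      by (subst min_mult_distrib_left) simp
    ultimately have eq: "real n powr (1 - \<beta>) * (k * min (?\<alpha> / (4 * real n * \<sigma> n)) 1)
        = k * min (real n powr \<kappa> / 8) (real n powr (1 - \<beta>))"
      by (simp only: mult.left_commute[of _ k] mult_1_right)
    have min_ge: "real n powr r / 8 \<le> min (real n powr \<kappa> / 8) (real n powr (1 - \<beta>))"
    proof (rule min.boundedI)
      show "real n powr r / 8 \<le> real n powr \<kappa> / 8"
        using powr_mono[of r \<kappa> "real n"] n by (simp add: r_def)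
      have "real n powr r \<le> real n powr (1 - \<beta>)"
        using n by (intro powr_mono) (simp_all add: r_def)
      moreover have "0 \<le> real n powr r" by simp
      ultimately show "real n powr r / 8 \<le> real n powr (1 - \<beta>)" by linarith
    qed
    have "k / 8 * real n powr r = k * (real n powr r / 8)" by simp
    also have "\<dots> \<le> k * min (real n powr \<kappa> / 8) (real n powr (1 - \<beta>))"
      using min_ge k by (intro mult_left_mono) auto
    also have "\<dots> \<le> real n powr (1 - \<beta>) * extreme_mass n ?\<alpha> (\<sigma> n)"
      unfolding eq[symmetric]
      using extreme_mass_ge_central[OF elim \<alpha>01 pos]
      by (intro mult_left_mono) (auto simp: k_def)
    finally show "k / 8 * real n powr r \<le> real n powr (1 - \<beta>) * extreme_mass n ?\<alpha> (\<sigma> n)" .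
  qed (use \<beta> \<kappa> k r \<epsilon> in auto)
qed

text \<open>The gap between \<open>1 / s\<^sup>2\<close> and \<open>1 - \<beta>\<close> leaves room for an exponent
  \<open>\<theta>\<close> slightly above \<open>1 / s\<^sup>2\<close> at which the tails can be compared.\<close>

lemma powerful_wide:
  fixes \<beta> s :: real
  assumes \<beta>: "0 < \<beta>" "\<beta> < 1" and s: "0 < s" "1 / s\<^sup>2 < 1 - \<beta>"
    and \<epsilon>: "\<And>n. n \<ge> 1 \<Longrightarrow> \<epsilon> n = real n powr (- \<beta>)"
    and \<sigma>: "\<And>n. n \<ge> 1 \<Longrightarrow> \<sigma> n = s"
  shows "extremes_test_powerful \<epsilon> \<sigma>"
proof -
  obtain \<theta> where \<theta>: "1 / s\<^sup>2 < \<theta>" "\<theta> < 1 - \<beta>" using dense[OF s(2)] by blast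
  have "0 < 1 / s\<^sup>2" using s by simp
  then have \<theta>0: "0 < \<theta>" using \<theta> by linarith
  \<comment> \<open>The expected number of extreme effects is at least of order
    \<open>n powr (1 - \<beta> - (1 + \<kappa>) * \<theta>)\<close>; this \<open>\<kappa>\<close> halves the exponent \<open>1 - \<beta> - \<theta>\<close> available at
    \<open>\<kappa> = 0\<close>.\<close>
  define \<kappa> where "\<kappa> = ((1 - \<beta>) / \<theta> - 1) / 2"
  define r where "r = (1 - \<beta> - \<theta>) / 2"
  have \<kappa>: "0 < \<kappa>" and r: "0 < r" using \<theta> \<theta>0 by (auto simp: \<kappa>_def r_def)
  have \<kappa>r: "1 - \<beta> - (1 + \<kappa>) * \<theta> = r" using \<theta>0 by (simp add: \<kappa>_def r_def field_simps)
  obtain K where K: "0 < K"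
    "\<And>n \<alpha>. 1 \<le> n \<Longrightarrow> 0 < \<alpha> \<Longrightarrow> \<alpha> < 1 \<Longrightarrow> K * (\<alpha> / (2 * real n)) powr \<theta> \<le> extreme_mass n \<alpha> s"
    using extreme_mass_ge_tail[OF s(1) \<theta>(1)] by blast
  show ?thesis
  proof (rule powerful_if_power_growth[where \<kappa> = \<kappa> and k = "K / 4 powr \<theta>" and r = r])
    show "0 < \<sigma> n" if "1 \<le> n" for n using that s by (simp add: \<sigma>)
    fix n :: nat assume elim: "1 \<le> n"
    let ?\<alpha> = "real n powr (- \<kappa>) / 2"
    have \<alpha>01: "0 < ?\<alpha>" "?\<alpha> < 1"
      using powr_mono[of "- \<kappa>" 0 "real n"] \<kappa> elim by simp_all
    have "real n powr (- (1 + \<kappa>)) = real n powr (- \<kappa>) * real n powr (- 1)"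
    proof -
      have "- (1 + \<kappa>) = - \<kappa> + - 1" by simp
      then show ?thesis by (simp only: powr_add)
    qed
    then have "?\<alpha> / (2 * real n) = real n powr (- (1 + \<kappa>)) / 4"
      using elim by (simp add: powr_minus_divide)
    then have "(?\<alpha> / (2 * real n)) powr \<theta> = real n powr (- (1 + \<kappa>) * \<theta>) / 4 powr \<theta>"
      by (simp only: powr_divide powr_powr)
    then have "real n powr (1 - \<beta>) * (K * (?\<alpha> / (2 * real n)) powr \<theta>)
        = K / 4 powr \<theta> * (real n powr (1 - \<beta>) * real n powr (- (1 + \<kappa>) * \<theta>))"
      by simp
    also have "\<dots> = K / 4 powr \<theta> * real n powr r"
    proof -
      have "1 - \<beta> + - (1 + \<kappa>) * \<theta> = r" using \<kappa>r by (simp add: algebra_simps)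
      then show ?thesis by (simp only: powr_add[symmetric])
    qed
    finally have "K / 4 powr \<theta> * real n powr r
        = real n powr (1 - \<beta>) * (K * (?\<alpha> / (2 * real n)) powr \<theta>)" ..
    also have "\<dots> \<le> real n powr (1 - \<beta>) * extreme_mass n ?\<alpha> (\<sigma> n)"
      using K(2)[OF elim \<alpha>01] by (intro mult_left_mono) (auto simp: \<sigma>[OF elim])
    finally show "K / 4 powr \<theta> * real n powr r \<le> real n powr (1 - \<beta>) * extreme_mass n ?\<alpha> (\<sigma> n)" .
  qed (use \<beta> \<kappa> K(1) r \<epsilon> in auto)
qed

text \<open>The constant \<open>b\<close> allows one treatment of shrinking standard deviations (\<open>b = 1\<close>) and of
  fixed standard deviations up to \<open>1\<close> (\<open>\<gamma> = 0\<close>).\<close>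

lemma powerless_narrow:
  fixes \<beta> \<gamma> b :: real
  assumes \<beta>: "0 < \<beta>" and \<gamma>: "0 \<le> \<gamma>" "\<gamma> < \<beta>" and b: "0 < b" "b \<le> 1"
    and \<epsilon>: "\<And>n. n \<ge> 1 \<Longrightarrow> \<epsilon> n = real n powr (- \<beta>)"
    and \<sigma>: "\<And>n. n \<ge> 1 \<Longrightarrow> \<sigma> n = b * real n powr (- \<gamma>)"
  shows "extremes_test_powerless \<epsilon> \<sigma>"
  unfolding extremes_test_powerless_def
proof (intro allI impI)
  fix \<alpha> :: "nat \<Rightarrow> real" assume \<alpha>: "\<forall>n. 0 < \<alpha> n \<and> \<alpha> n < 1"
  define K where "K = (1 / std_normal_density 1 + 1) / b"
  show "asymptotically_powerless H0 (\<lambda>n. H1 (\<epsilon> n) (\<sigma> n) n) (\<lambda>n. extremes_test n (\<alpha> n))"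
  proof (rule asymptotically_powerless_if_few_extreme)
    show "0 < \<alpha> n \<and> \<alpha> n < 1" for n using \<alpha> by simp
    show "0 \<le> \<epsilon> n \<and> \<epsilon> n \<le> 1" if "1 \<le> n" for n
      using powr_mono[of "- \<beta>" 0 "real n"] that \<beta> by (simp add: \<epsilon>)
    show pos: "0 < \<sigma> n" if "1 \<le> n" for n using that b by (simp add: \<sigma>)
    have "(\<lambda>n. real n powr (\<gamma> - \<beta>)) \<longlonglongrightarrow> 0" using \<gamma> by real_asymp
    then show "(\<lambda>n. K * real n powr (\<gamma> - \<beta>)) \<longlonglongrightarrow> 0" by (rule tendsto_mult_right_zero)
    show "real n * \<epsilon> n * extreme_mass n (\<alpha> n) (\<sigma> n) \<le> K * real n powr (\<gamma> - \<beta>)" if n: "1 \<le> n" for n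
    proof -
      have "\<sigma> n \<le> 1"
        using powr_mono[of "- \<gamma>" 0 "real n"] n \<gamma> b by (simp add: \<sigma> mult_le_one)
      then have "\<epsilon> n * (real n * extreme_mass n (\<alpha> n) (\<sigma> n)) \<le> \<epsilon> n * ((1 / std_normal_density 1 + 1) / \<sigma> n)"
        using extreme_mass_le_narrow[OF n, of "\<alpha> n" "\<sigma> n"] \<alpha> pos[OF n]
        by (intro mult_left_mono) (auto simp: \<epsilon>[OF n])
      also have "\<dots> = K * (real n powr (- \<beta>) / real n powr (- \<gamma>))"
        by (simp add: K_def \<epsilon>[OF n] \<sigma>[OF n])
      also have "\<dots> = K * real n powr (\<gamma> - \<beta>)"
        by (simp add: powr_diff[symmetric])
      finally show ?thesis by (simp add: mult_ac)
    qed
  qed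
qed

lemma powerless_wide:
  fixes \<beta> s :: real
  assumes \<beta>: "0 < \<beta>" "\<beta> < 1" and s: "1 \<le> s" "1 - \<beta> < 1 / s\<^sup>2"
    and \<epsilon>: "\<And>n. n \<ge> 1 \<Longrightarrow> \<epsilon> n = real n powr (- \<beta>)"
    and \<sigma>: "\<And>n. n \<ge> 1 \<Longrightarrow> \<sigma> n = s"
  shows "extremes_test_powerless \<epsilon> \<sigma>"
  unfolding extremes_test_powerless_def
proof (intro allI impI)
  fix \<alpha> :: "nat \<Rightarrow> real" assume \<alpha>: "\<forall>n. 0 < \<alpha> n \<and> \<alpha> n < 1"
  obtain \<theta> where \<theta>: "1 - \<beta> < \<theta>" "\<theta> < 1 / s\<^sup>2" using dense[OF s(2)] by blast
  obtain K where K: "\<And>n \<alpha>. 1 \<le> n \<Longrightarrow> 0 < \<alpha> \<Longrightarrow> \<alpha> < 1 \<Longrightarrow> extreme_mass n \<alpha> s \<le> K * real n powr - \<theta>"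
    using extreme_mass_le_wide[of s \<theta>] \<theta> \<beta> s by auto
  show "asymptotically_powerless H0 (\<lambda>n. H1 (\<epsilon> n) (\<sigma> n) n) (\<lambda>n. extremes_test n (\<alpha> n))"
  proof (rule asymptotically_powerless_if_few_extreme)
    show "0 < \<alpha> n \<and> \<alpha> n < 1" for n using \<alpha> by simp
    show "0 \<le> \<epsilon> n \<and> \<epsilon> n \<le> 1" if "1 \<le> n" for n
      using powr_mono[of "- \<beta>" 0 "real n"] that \<beta> by (simp add: \<epsilon>)
    show "0 < \<sigma> n" if "1 \<le> n" for n using that s by (simp add: \<sigma>)
    have "(\<lambda>n. real n powr (1 - \<beta> - \<theta>)) \<longlonglongrightarrow> 0" using \<theta> by real_asymp
    then show "(\<lambda>n. K * real n powr (1 - \<beta> - \<theta>)) \<longlonglongrightarrow> 0" by (rule tendsto_mult_right_zero)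
    show "real n * \<epsilon> n * extreme_mass n (\<alpha> n) (\<sigma> n) \<le> K * real n powr (1 - \<beta> - \<theta>)" if n: "1 \<le> n" for n
    proof -
      have "real n * \<epsilon> n * extreme_mass n (\<alpha> n) (\<sigma> n) \<le> real n * \<epsilon> n * (K * real n powr - \<theta>)"
        using K[OF n, of "\<alpha> n"] \<alpha> by (intro mult_left_mono) (auto simp: \<epsilon>[OF n] \<sigma>[OF n])
      also have "\<dots> = K * (real n powr 1 * real n powr (- \<beta>) * real n powr - \<theta>)"
        by (simp add: \<epsilon>[OF n])
      also have "\<dots> = K * real n powr (1 - \<beta> - \<theta>)"
        by (simp only: powr_add[symmetric]) simp
      finally show ?thesis .
    qed
  qed
qed

theorem proposition2:
  fixes \<beta> :: real and \<epsilon> \<sigma> :: "nat \<Rightarrow> real"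
  assumes "0 < \<beta>" and "\<beta> < 1"
    and "\<And>n. n \<ge> 1 \<Longrightarrow> \<epsilon> n = real n powr (- \<beta>)"
    and "\<And>n. n \<ge> 1 \<Longrightarrow> \<sigma> n > 0"
  shows "(\<forall>\<gamma>>0. (\<forall>n\<ge>1. \<sigma> n = real n powr (- \<gamma>)) \<longrightarrow>
            (\<gamma> > \<beta> \<longrightarrow> extremes_test_powerful \<epsilon> \<sigma>) \<and>
            (\<gamma> < \<beta> \<longrightarrow> extremes_test_powerless \<epsilon> \<sigma>)) \<and>
         (\<forall>s>0. (\<forall>n\<ge>1. \<sigma> n = s) \<longrightarrow>
            (s > 1 / sqrt (1 - \<beta>) \<longrightarrow> extremes_test_powerful \<epsilon> \<sigma>) \<and>
            (s < 1 / sqrt (1 - \<beta>) \<longrightarrow> extremes_test_powerless \<epsilon> \<sigma>))"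
proof (intro conjI allI impI)
  fix \<gamma> :: real
  assume "0 < \<gamma>" and \<sigma>: "\<forall>n\<ge>1. \<sigma> n = real n powr (- \<gamma>)"
  show "extremes_test_powerful \<epsilon> \<sigma>" if "\<beta> < \<gamma>"
    using powerful_narrow[of \<beta> \<gamma> \<epsilon> \<sigma>] assms \<sigma> that by auto
  show "extremes_test_powerless \<epsilon> \<sigma>" if "\<gamma> < \<beta>"
    using powerless_narrow[of \<beta> \<gamma> 1 \<epsilon> \<sigma>] assms \<sigma> that \<open>0 < \<gamma>\<close> by auto
next
  fix s :: real
  assume s: "0 < s" and \<sigma>: "\<forall>n\<ge>1. \<sigma> n = s"
  define q where "q = sqrt (1 - \<beta>)"
  have q: "0 < q" "1 - \<beta> = q\<^sup>2" using assms by (simp_all add: q_def)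
  have root: "1 / s\<^sup>2 = (1 / s)\<^sup>2" by (simp add: power_divide)
  show "extremes_test_powerful \<epsilon> \<sigma>" if "1 / sqrt (1 - \<beta>) < s"
  proof -
    have "1 / s < q" using that s q by (simp add: q_def[symmetric] field_simps)
    then have "1 / s\<^sup>2 < 1 - \<beta>" unfolding root q(2) using s by (intro power_strict_mono) auto
    then show ?thesis using powerful_wide[of \<beta> s \<epsilon> \<sigma>] assms s \<sigma> by auto
  qed
  show "extremes_test_powerless \<epsilon> \<sigma>" if "s < 1 / sqrt (1 - \<beta>)"
  proof (cases "s \<le> 1")
    case True
    then show ?thesis using powerless_narrow[of \<beta> 0 s \<epsilon> \<sigma>] assms s \<sigma> by auto
  next
    case False
    have "q < 1 / s" using that s q by (simp add: q_def[symmetric] field_simps)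
    then have "1 - \<beta> < 1 / s\<^sup>2" unfolding root q(2) using q by (intro power_strict_mono) auto
    then show ?thesis using powerless_wide[of \<beta> s \<epsilon> \<sigma>] assms False \<sigma> by auto
  qed
qed

end
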